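(* We have $\min_{k,l\ge 2} N_{k,l} = 7$ (minimum over all pairs of integers $k,l\ge 2$), which implies that $g_{k,l}(n)\in\mathbb{Z}$ for all integers $k,l\ge 2$ and $1\le n\le 6$. Moreover, for integers $k,l\ge 2$, we have $N_{k,l}=7$ if and only if $k\equiv 2\pmod 6$ and $l\equiv 3\pmod 7$.
   Context: For integers $k,l\ge 2$, the $(k,l)$-Göbel sequence $(g_{k,l}(n))_{n\ge 1}$ of rational numbers is defined by $g_{k,l}(1)=l$ and the recursion $(n+1)\,g_{k,l}(n+1)=g_{k,l}(n)\,\bigl(n+g_{k,l}(n)^{k-1}\bigr)$ for $n\ge 1$. Define $N_{k,l}=\inf\{n\in\mathbb{Z}_{>0} : g_{k,l}(n)\notin\mathbb{Z}\}$, with the convention $\inf\emptyset=\infty$. *)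

theory Defs
  imports "HOL-Number_Theory.Number_Theory" "HOL-Library.Extended_Nat"
begin

text \<open>The sequence starts at index 1; the value at index 0 is junk.\<close>

fun goebel :: "nat \<Rightarrow> nat \<Rightarrow> nat \<Rightarrow> rat" where
  "goebel k l 0 = 0"
| "goebel k l (Suc 0) = of_nat l"
| "goebel k l (Suc (Suc n)) =
     goebel k l (Suc n) * (of_nat (Suc n) + goebel k l (Suc n) ^ (k - 1)) / of_nat (Suc (Suc n))"

lemma goebel_1: "goebel k l 1 = of_nat l"
  by simp

lemma goebel_rec:
  assumes "n \<ge> 1"
  shows "of_nat (n + 1) * goebel k l (n + 1) = goebel k l n * (of_nat n + goebel k l n ^ (k - 1))"
proof -
  obtain m where n: "n = Suc m"
    using assms by (cases n) auto
  have "(of_nat (Suc (Suc m)) :: rat) \<noteq> 0"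
    by (simp only: of_nat_eq_0_iff)
  then show ?thesis
    unfolding n Suc_eq_plus1[symmetric] goebel.simps(3) by (simp del: of_nat_Suc)
qed

text \<open>In \<^typ>\<open>enat\<close> the infimum of the empty set is \<open>\<infinity>\<close>.\<close>

definition goebel_N :: "nat \<Rightarrow> nat \<Rightarrow> enat" where
  "goebel_N k l = Inf {enat n | n. n > 0 \<and> goebel k l n \<notin> \<int>}"

end

theory Submission
  imports Defs "HOL-Library.Code_Binary_Nat"
begin

text \<open>As long as the terms are integers, the recursion can be followed modulo a prime power
  \<open>p\<^sup>j\<close>, where each division by a multiple of \<open>p\<close> costs digits of precision. Up to \<open>n = 6\<close> the
  moduli 16, 9 and 5 suffice for the primes 2, 3 and 5, and the term \<open>n = 7\<close> is decided modulo 7.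
  Since powers are eventually periodic in the exponent, this leaves finitely many pairs of a
  residue of \<open>l\<close> and an exponent.\<close>

section \<open>A model of the sequence in the natural numbers\<close>

text \<open>The truncating \<open>div\<close> makes this total; it follows \<open>goebel\<close>
  only as long as every earlier division is exact. The exponent \<open>e\<close> stands for
  \<open>k - 1\<close>, and index 0 is junk.\<close>

definition goebel_nat :: "nat \<Rightarrow> nat \<Rightarrow> nat \<Rightarrow> nat" where
  "goebel_nat e l n =
     rec_nat l (\<lambda>i a. a * (Suc i + a ^ e) div Suc (Suc i)) (n - 1)"

text \<open>Indexed by the term before the division: step 6 decides whether term 7 is an
  integer.\<close>

definition step_dvd :: "nat \<Rightarrow> nat \<Rightarrow> nat \<Rightarrow> bool" where
  "step_dvd e l n \<longleftrightarrow> Suc n dvd goebel_nat e l n * (n + goebel_nat e l n ^ e)"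

text \<open>Here \<open>n + 1 = d * u\<close>, the residue \<open>r\<close> of the term \<open>n\<close> is known modulo \<open>d * m\<close>, and \<open>v\<close> is an
  inverse of \<open>u\<close> modulo \<open>m\<close>.\<close>

definition residue_step :: "nat \<Rightarrow> nat \<Rightarrow> nat \<Rightarrow> nat \<Rightarrow> nat \<Rightarrow> nat \<Rightarrow> nat" where
  "residue_step d v m n e r = v * (r * (n + r ^ e) mod (d * m) div d) mod m"

lemma goebel_nat_1: "goebel_nat e l 1 = l"
  by (simp add: goebel_nat_def)

lemma goebel_nat_Suc:
  assumes "n \<ge> 1" "step_dvd e l n"
  shows "Suc n * goebel_nat e l (Suc n) = goebel_nat e l n * (n + goebel_nat e l n ^ e)"
proof -
  obtain m where n: "n = Suc m" using assms(1) by (cases n) auto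
  have "goebel_nat e l (Suc n) = goebel_nat e l n * (n + goebel_nat e l n ^ e) div Suc n"
    by (simp add: n goebel_nat_def)
  then show ?thesis using assms(2) unfolding step_dvd_def by (simp only: dvd_mult_div_cancel)
qed

lemma goebel_eq_goebel_nat:
  assumes "n \<ge> 1" "\<And>i. 1 \<le> i \<Longrightarrow> i < n \<Longrightarrow> step_dvd (k - 1) l i"
  shows "goebel k l n = of_nat (goebel_nat (k - 1) l n)"
  using assms
proof (induction n rule: dec_induct)
  case base
  show ?case by (simp add: goebel_nat_1[unfolded One_nat_def])
next
  case (step n)
  let ?a = "goebel_nat (k - 1) l n"
  have IH: "goebel k l n = of_nat ?a" using step by simp
  have "of_nat (Suc n) * goebel k l (Suc n) = of_nat (?a * (n + ?a ^ (k - 1)))"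
    using goebel_rec[OF step(1), of k l] IH by simp
  also have "?a * (n + ?a ^ (k - 1)) = Suc n * goebel_nat (k - 1) l (Suc n)"
    using step by (intro goebel_nat_Suc[symmetric]) auto
  also have "of_nat \<dots> = (of_nat (Suc n) * of_nat (goebel_nat (k - 1) l (Suc n)) :: rat)"
    by (rule of_nat_mult)
  finally show ?case by (simp del: of_nat_Suc)
qed

lemma goebel_Suc_Ints_iff:
  assumes "n \<ge> 1" "\<And>i. 1 \<le> i \<Longrightarrow> i < n \<Longrightarrow> step_dvd (k - 1) l i"
  shows "goebel k l (Suc n) \<in> \<int> \<longleftrightarrow> step_dvd (k - 1) l n"
proof
  let ?a = "goebel_nat (k - 1) l n"
  assume "goebel k l (Suc n) \<in> \<int>"
  then obtain z where z: "goebel k l (Suc n) = of_int z" by (auto elim: Ints_cases)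
  have "of_nat (Suc n) * goebel k l (Suc n) = of_nat (?a * (n + ?a ^ (k - 1)))"
    using goebel_rec[OF assms(1), of k l] goebel_eq_goebel_nat[OF assms] by simp
  then have "(of_int (int (Suc n) * z) :: rat) = of_int (int (?a * (n + ?a ^ (k - 1))))"
    using z by simp
  then have "int (Suc n) * z = int (?a * (n + ?a ^ (k - 1)))"
    by (simp only: of_int_eq_iff)
  then have "int (Suc n) dvd int (?a * (n + ?a ^ (k - 1)))"
    by (metis dvd_triv_left)
  then show "step_dvd (k - 1) l n"
    unfolding step_dvd_def by (simp only: of_nat_dvd_iff)
next
  assume "step_dvd (k - 1) l n"
  then have "goebel k l (Suc n) = of_nat (goebel_nat (k - 1) l (Suc n))"
    using assms by (intro goebel_eq_goebel_nat) (auto simp: less_Suc_eq)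
  then show "goebel k l (Suc n) \<in> \<int>" by simp
qed

section \<open>Periodicity of powers and propagation of residues\<close>

text \<open>Powers have preperiod \<open>c\<close> and period \<open>p\<close>, so subtracting
  \<open>p\<close> from an exponent that is at least \<open>c + p\<close> changes no power modulo
  \<open>m\<close>; strong induction brings the exponent below \<open>c + p\<close>. As
  \<open>c\<close> is positive, exponent 0 is never reached.\<close>

lemma power_cong_bounded_exponent:
  fixes c p m e :: nat
  assumes period: "\<And>x. x < m \<Longrightarrow> x ^ (c + p) mod m = x ^ c mod m"
    and "m > 0" "c \<ge> 1" "p \<ge> 1" "e \<ge> 1"
  obtains e' where "e' \<in> {1..<c + p}" "[e = e'] (mod p)" "\<And>x. [x ^ e = x ^ e'] (mod m)"
proof -
  have "\<exists>e'\<in>{1..<c + p}. [e = e'] (mod p) \<and> (\<forall>x. [x ^ e = x ^ e'] (mod m))"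
    using \<open>e \<ge> 1\<close>
  proof (induction e rule: less_induct)
    case (less e)
    show ?case
    proof (cases "e < c + p")
      case True
      then show ?thesis using less.prems by (intro bexI[of _ e]) auto
    next
      case False
      then obtain f where f: "e = f + (c + p)" by (metis le_iff_add add.commute not_less)
      obtain e' where e': "e' \<in> {1..<c + p}" "[f + c = e'] (mod p)"
        "\<And>x. [x ^ (f + c) = x ^ e'] (mod m)"
        using less.IH[of "f + c"] f assms by auto
      have "[x ^ e = x ^ (f + c)] (mod m)" for x
      proof -
        have "[x ^ (c + p) = x ^ c] (mod m)"
          using period[of "x mod m"] \<open>m > 0\<close> by (simp add: cong_def power_mod)
        then show ?thesis unfolding f power_add[of x f] by (rule cong_scalar_left)
      qed
      moreover have "[e = f + c] (mod p)" by (simp add: f cong_def flip: add.assoc)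
      ultimately show ?thesis using e' by (meson cong_trans)
    qed
  qed
  then show thesis using that by blast
qed

text \<open>The exponent is reduced once modulo a large \<open>M\<close> and then serves every
  divisor \<open>m\<close> of it, while the precision of the residues shrinks.\<close>

lemma step_value_cong:
  fixes a n e e' m :: nat
  assumes "\<And>x. [x ^ e = x ^ e'] (mod M)" "m dvd M"
  shows "[a * (n + a ^ e) = (a mod m) * (n + (a mod m) ^ e')] (mod m)"
proof -
  have "[a ^ e = (a mod m) ^ e'] (mod m)"
    using cong_dvd_modulus_nat[OF assms(1) assms(2), of a] by (simp add: cong_def power_mod)
  then show ?thesis by (intro cong_mult cong_add) (auto simp: cong_def)
qed

lemma goebel_nat_Suc_mod:
  assumes "n \<ge> 1" "step_dvd e l n" "Suc n = d * u" "[v * u = 1] (mod m)"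
    and "\<And>x. [x ^ e = x ^ e'] (mod M)" "d * m dvd M"
    and "goebel_nat e l n mod (d * m) = r"
  shows "goebel_nat e l (Suc n) mod m = residue_step d v m n e' r"
proof -
  let ?a = "goebel_nat e l n" and ?b = "goebel_nat e l (Suc n)"
  have "d > 0" using assms(3) by (cases d) auto
  \<comment> \<open>Pulling \<open>d\<close> out of the remainder is where precision drops from
    \<open>d * m\<close> to \<open>m\<close>; the unit part \<open>u\<close> is inverted
    afterwards.\<close>
  have "d * (u * ?b mod m) = d * u * ?b mod (d * m)"
    by (simp add: mod_mult_mult1 mult.assoc)
  also have "d * u * ?b = ?a * (n + ?a ^ e)"
    using goebel_nat_Suc[OF assms(1,2)] assms(3) by simp
  also have "\<dots> mod (d * m) = r * (n + r ^ e') mod (d * m)"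
    using step_value_cong[OF assms(5,6), of ?a n] assms(7) by (simp add: cong_def)
  finally have "u * ?b mod m = r * (n + r ^ e') mod (d * m) div d"
    using \<open>d > 0\<close> by (metis nonzero_mult_div_cancel_left less_not_refl)
  then have "residue_step d v m n e' r = v * (u * ?b) mod m"
    by (metis residue_step_def mod_mult_right_eq)
  also have "\<dots> = ?b mod m"
    using cong_scalar_right[OF assms(4), of ?b] by (simp add: cong_def mult.assoc)
  finally show ?thesis ..
qed

lemma dvd_step_value_iff:
  fixes p :: nat
  assumes "\<And>x. [x ^ e = x ^ e'] (mod M)" "p dvd M" "goebel_nat e l n mod p = r"
  shows "p dvd goebel_nat e l n * (n + goebel_nat e l n ^ e) \<longleftrightarrow> r * (n + r ^ e') mod p = 0"
  using step_value_cong[OF assms(1,2), of "goebel_nat e l n" n] assms(3)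
  by (simp add: cong_def dvd_eq_mod_eq_0)

section \<open>Finite checks modulo 16, 9, 5 and 7\<close>

text \<open>Dividing by 2, 3, 4, 5 takes the modulus through 16, 8, 8, 2, 2. This leaves enough to
  test the divisor 4 at step 3 and the factor 2 of 6 at step 5.\<close>

lemma check_mod_16:
  "\<forall>r\<in>set [0..<16]. \<forall>e\<in>set [1..<8].
     let r3 = residue_step 1 3 8 2 e (residue_step 2 1 8 1 e r);
         r5 = residue_step 1 1 2 4 e (residue_step 4 1 2 3 e r3)
     in r3 mod 4 * (3 + (r3 mod 4) ^ e) mod 4 = 0 \<and> r5 * (5 + r5 ^ e) mod 2 = 0"
  by code_simp

text \<open>Only the division by 3 costs precision, from 9 to 3; the remaining digit tests the
  factor 3 of 6 at step 5.\<close>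

lemma check_mod_9:
  "\<forall>r\<in>set [0..<9]. \<forall>e\<in>set [1..<8].
     let r2 = residue_step 1 5 9 1 e r;
         r5 = residue_step 1 2 3 4 e (residue_step 1 1 3 3 e (residue_step 3 1 3 2 e r2))
     in r2 mod 3 * (2 + (r2 mod 3) ^ e) mod 3 = 0 \<and> r5 * (5 + r5 ^ e) mod 3 = 0"
  by code_simp

lemma check_mod_5:
  "\<forall>r\<in>set [0..<5]. \<forall>e\<in>set [1..<5].
     let r4 = residue_step 1 4 5 3 e (residue_step 1 2 5 2 e (residue_step 1 3 5 1 e r))
     in r4 * (4 + r4 ^ e) mod 5 = 0"
  by code_simp

lemma check_mod_7:
  "\<forall>r\<in>set [0..<7]. \<forall>e\<in>set [1..<7].
     let r4 = residue_step 1 2 7 3 e (residue_step 1 5 7 2 e (residue_step 1 4 7 1 e r));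
         r6 = residue_step 1 6 7 5 e (residue_step 1 3 7 4 e r4)
     in r6 * (6 + r6 ^ e) mod 7 = 0 \<longleftrightarrow> \<not> (e = 1 \<and> r = 3)"
  by code_simp

section \<open>Divisibility in the first six steps\<close>

text \<open>For positive \<open>e\<close>, \<open>l\<close> and \<open>l ^ e\<close> have the same
  parity.\<close>

lemma step_dvd_1: "e \<ge> 1 \<Longrightarrow> step_dvd e l 1"
  by (simp add: step_dvd_def flip: numeral_2_eq_2)

text \<open>A single pass modulo 16 serves both claims. The second is conditional because step 3
  needs the first claim and step 4 is settled modulo 5.\<close>

lemma step_2_power_part:
  assumes "e \<ge> 1" "step_dvd e l 1" "step_dvd e l 2"
  shows "4 dvd goebel_nat e l 3 * (3 + goebel_nat e l 3 ^ e)"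
    and "step_dvd e l 3 \<Longrightarrow> step_dvd e l 4 \<Longrightarrow>
         2 dvd goebel_nat e l 5 * (5 + goebel_nat e l 5 ^ e)"
proof -
  \<comment> \<open>Fourth powers of even numbers vanish modulo 16, and fourth powers of odd numbers
    are 1: preperiod 4, period 4.\<close>
  have "\<forall>x\<in>set [0..<16]. x ^ (4 + 4) mod 16 = x ^ 4 mod (16::nat)"
    by code_simp
  then have "x ^ (4 + 4) mod 16 = x ^ 4 mod 16" if "x < 16" for x :: nat
    using that by simp
  then obtain e' where e': "e' \<in> {1..<4 + 4}" "[e = e'] (mod 4)"
    "\<And>x :: nat. [x ^ e = x ^ e'] (mod 16)"
    using power_cong_bounded_exponent[of 16 4 4 e] assms(1) by auto
  let ?r = "goebel_nat e l 1 mod 16"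
  let ?r3 = "residue_step 1 3 8 2 e' (residue_step 2 1 8 1 e' ?r)"
  let ?r5 = "residue_step 1 1 2 4 e' (residue_step 4 1 2 3 e' ?r3)"
  have check: "?r3 mod 4 * (3 + (?r3 mod 4) ^ e') mod 4 = 0" "?r5 * (5 + ?r5 ^ e') mod 2 = 0"
    using check_mod_16[rule_format, of ?r e'] e'(1) by (simp_all add: Let_def)
  have "goebel_nat e l (Suc 1) mod 8 = residue_step 2 1 8 1 e' ?r"
    using assms by (intro goebel_nat_Suc_mod[where M = 16 and u = 1] e'(3)) auto
  then have "goebel_nat e l (Suc 2) mod 8 = ?r3"
    using assms by (intro goebel_nat_Suc_mod[where M = 16 and u = 3] e'(3))
      (auto simp: cong_def numeral_2_eq_2)
  then have r3: "goebel_nat e l 3 mod 8 = ?r3" by simp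
  have "goebel_nat e l 3 mod 4 = ?r3 mod 4"
    using arg_cong[OF r3, of "\<lambda>x. x mod 4"] by (simp add: mod_mod_cancel)
  then show "4 dvd goebel_nat e l 3 * (3 + goebel_nat e l 3 ^ e)"
    using dvd_step_value_iff[OF e'(3)] check(1) by simp
  assume "step_dvd e l 3" "step_dvd e l 4"
  have "goebel_nat e l (Suc 3) mod 2 = residue_step 4 1 2 3 e' ?r3"
    using r3 \<open>step_dvd e l 3\<close> by (intro goebel_nat_Suc_mod[where M = 16 and u = 1] e'(3)) auto
  then have "goebel_nat e l (Suc 4) mod 2 = ?r5"
    using \<open>step_dvd e l 4\<close> by (intro goebel_nat_Suc_mod[where M = 16 and u = 5] e'(3))
      (auto simp: cong_def)
  then show "2 dvd goebel_nat e l 5 * (5 + goebel_nat e l 5 ^ e)"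
    using dvd_step_value_iff[OF e'(3), of 2 l 5] check(2) by simp
qed

lemma step_3_power_part:
  assumes "e \<ge> 1" "step_dvd e l 1"
  shows "step_dvd e l 2"
    and "step_dvd e l 2 \<Longrightarrow> step_dvd e l 3 \<Longrightarrow> step_dvd e l 4 \<Longrightarrow>
         3 dvd goebel_nat e l 5 * (5 + goebel_nat e l 5 ^ e)"
proof -
  \<comment> \<open>Squares of multiples of 3 vanish modulo 9, and the units form a group of order
    6: preperiod 2, period 6.\<close>
  have "\<forall>x\<in>set [0..<9]. x ^ (2 + 6) mod 9 = x ^ 2 mod (9::nat)"
    by code_simp
  then have "x ^ (2 + 6) mod 9 = x ^ 2 mod 9" if "x < 9" for x :: nat
    using that by simp
  then obtain e' where e': "e' \<in> {1..<2 + 6}" "[e = e'] (mod 6)"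
    "\<And>x :: nat. [x ^ e = x ^ e'] (mod 9)"
    using power_cong_bounded_exponent[of 9 2 6 e] assms(1) by auto
  let ?r = "goebel_nat e l 1 mod 9"
  let ?r2 = "residue_step 1 5 9 1 e' ?r"
  let ?r4 = "residue_step 1 1 3 3 e' (residue_step 3 1 3 2 e' ?r2)"
  let ?r5 = "residue_step 1 2 3 4 e' ?r4"
  have check: "?r2 mod 3 * (2 + (?r2 mod 3) ^ e') mod 3 = 0" "?r5 * (5 + ?r5 ^ e') mod 3 = 0"
    using check_mod_9[rule_format, of ?r e'] e'(1) by (simp_all add: Let_def)
  have "goebel_nat e l (Suc 1) mod 9 = ?r2"
    using assms by (intro goebel_nat_Suc_mod[where M = 9 and u = 2] e'(3)) (auto simp: cong_def)
  then have r2: "goebel_nat e l 2 mod 9 = ?r2" by (simp add: numeral_2_eq_2)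
  have "goebel_nat e l 2 mod 3 = ?r2 mod 3"
    using arg_cong[OF r2, of "\<lambda>x. x mod 3"] by (simp add: mod_mod_cancel)
  then show "step_dvd e l 2"
    using dvd_step_value_iff[OF e'(3), of 3 l 2] check(1) by (simp add: step_dvd_def)
  assume "step_dvd e l 2" "step_dvd e l 3" "step_dvd e l 4"
  have "goebel_nat e l (Suc 2) mod 3 = residue_step 3 1 3 2 e' ?r2"
    using r2 \<open>step_dvd e l 2\<close> by (intro goebel_nat_Suc_mod[where M = 9 and u = 1] e'(3)) auto
  then have "goebel_nat e l (Suc 3) mod 3 = ?r4"
    using \<open>step_dvd e l 3\<close> by (intro goebel_nat_Suc_mod[where M = 9 and u = 4] e'(3))
      (auto simp: cong_def)
  then have "goebel_nat e l (Suc 4) mod 3 = ?r5"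
    using \<open>step_dvd e l 4\<close> by (intro goebel_nat_Suc_mod[where M = 9 and u = 5] e'(3))
      (auto simp: cong_def)
  then show "3 dvd goebel_nat e l 5 * (5 + goebel_nat e l 5 ^ e)"
    using dvd_step_value_iff[OF e'(3), of 3 l 5] check(2) by simp
qed

text \<open>The earlier divisors 2, 3, 4 are units modulo 5, so no precision is lost. Fermat's
  theorem leaves the exponents 1 to 4.\<close>

lemma step_dvd_4:
  assumes "e \<ge> 1" "step_dvd e l 1" "step_dvd e l 2" "step_dvd e l 3"
  shows "step_dvd e l 4"
proof -
  have "\<forall>x\<in>set [0..<5]. x ^ (1 + 4) mod 5 = x ^ 1 mod (5::nat)"
    by code_simp
  then have "x ^ (1 + 4) mod 5 = x ^ 1 mod 5" if "x < 5" for x :: nat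
    using that by simp
  then obtain e' where e': "e' \<in> {1..<1 + 4}" "[e = e'] (mod 4)"
    "\<And>x :: nat. [x ^ e = x ^ e'] (mod 5)"
    using power_cong_bounded_exponent[of 5 1 4 e] assms(1) by auto
  let ?r = "goebel_nat e l 1 mod 5"
  let ?r3 = "residue_step 1 2 5 2 e' (residue_step 1 3 5 1 e' ?r)"
  let ?r4 = "residue_step 1 4 5 3 e' ?r3"
  have check: "?r4 * (4 + ?r4 ^ e') mod 5 = 0"
    using check_mod_5[rule_format, of ?r e'] e'(1) by (simp add: Let_def)
  have "goebel_nat e l (Suc 1) mod 5 = residue_step 1 3 5 1 e' ?r"
    using assms by (intro goebel_nat_Suc_mod[where M = 5 and u = 2] e'(3)) (auto simp: cong_def)
  then have "goebel_nat e l (Suc 2) mod 5 = ?r3"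
    using assms by (intro goebel_nat_Suc_mod[where M = 5 and u = 3] e'(3))
      (auto simp: cong_def numeral_2_eq_2)
  then have "goebel_nat e l (Suc 3) mod 5 = ?r4"
    using assms by (intro goebel_nat_Suc_mod[where M = 5 and u = 4] e'(3)) (auto simp: cong_def)
  then show ?thesis
    using dvd_step_value_iff[OF e'(3), of 5 l 4] check by (simp add: step_dvd_def)
qed

text \<open>All divisors from 2 to 6 are units modulo 7, so the residue of \<open>l\<close> and the
  exponent modulo 6 determine term 6 modulo 7. The finite check finds exactly one failing
  pair.\<close>

lemma step_dvd_6_iff:
  assumes "e \<ge> 1" and steps: "\<And>i. 1 \<le> i \<Longrightarrow> i \<le> 5 \<Longrightarrow> step_dvd e l i"
  shows "step_dvd e l 6 \<longleftrightarrow> \<not> ([e = 1] (mod 6) \<and> [l = 3] (mod 7))"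
proof -
  have "\<forall>x\<in>set [0..<7]. x ^ (1 + 6) mod 7 = x ^ 1 mod (7::nat)"
    by code_simp
  then have "x ^ (1 + 6) mod 7 = x ^ 1 mod 7" if "x < 7" for x :: nat
    using that by simp
  then obtain e' where e': "e' \<in> {1..<1 + 6}" "[e = e'] (mod 6)"
    "\<And>x :: nat. [x ^ e = x ^ e'] (mod 7)"
    using power_cong_bounded_exponent[of 7 1 6 e] assms(1) by auto
  let ?r = "goebel_nat e l 1 mod 7"
  let ?r3 = "residue_step 1 5 7 2 e' (residue_step 1 4 7 1 e' ?r)"
  let ?r5 = "residue_step 1 3 7 4 e' (residue_step 1 2 7 3 e' ?r3)"
  let ?r6 = "residue_step 1 6 7 5 e' ?r5"
  have check: "?r6 * (6 + ?r6 ^ e') mod 7 = 0 \<longleftrightarrow> \<not> (e' = 1 \<and> ?r = 3)"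
    using check_mod_7[rule_format, of ?r e'] e'(1) by (simp add: Let_def)
  have "goebel_nat e l (Suc 1) mod 7 = residue_step 1 4 7 1 e' ?r"
    using steps by (intro goebel_nat_Suc_mod[where M = 7 and u = 2] e'(3)) (auto simp: cong_def)
  then have "goebel_nat e l (Suc 2) mod 7 = ?r3"
    using steps by (intro goebel_nat_Suc_mod[where M = 7 and u = 3] e'(3))
      (auto simp: cong_def numeral_2_eq_2)
  then have "goebel_nat e l (Suc 3) mod 7 = residue_step 1 2 7 3 e' ?r3"
    using steps by (intro goebel_nat_Suc_mod[where M = 7 and u = 4] e'(3)) (auto simp: cong_def)
  then have "goebel_nat e l (Suc 4) mod 7 = ?r5"
    using steps by (intro goebel_nat_Suc_mod[where M = 7 and u = 5] e'(3)) (auto simp: cong_def)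
  then have "goebel_nat e l (Suc 5) mod 7 = ?r6"
    using steps by (intro goebel_nat_Suc_mod[where M = 7 and u = 6] e'(3)) (auto simp: cong_def)
  then have "step_dvd e l 6 \<longleftrightarrow> \<not> (e' = 1 \<and> ?r = 3)"
    using dvd_step_value_iff[OF e'(3), of 7 l 6] check by (simp add: step_dvd_def)
  \<comment> \<open>The representatives run from 1 to 6, with 6 in place of 0, so \<open>e'\<close>
    is determined by its class modulo 6.\<close>
  moreover have "e' = 1 \<longleftrightarrow> e' mod 6 = 1" using e'(1) by (cases "e' = 6") auto
  then have "e' = 1 \<longleftrightarrow> [e = 1] (mod 6)" using e'(2) by (simp add: cong_def)
  moreover have "?r = 3 \<longleftrightarrow> [l = 3] (mod 7)"
    unfolding goebel_nat_1 by (simp add: cong_def)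
  ultimately show ?thesis by simp
qed

text \<open>The primes must be interleaved, since tracking residues past a step presupposes its full
  divisibility: parity, then 3, 4 and 5, and finally 6 from its coprime factors 2 and 3.\<close>

lemma step_dvd_le_5:
  assumes "e \<ge> 1" "1 \<le> i" "i \<le> 5"
  shows "step_dvd e l i"
proof -
  have s1: "step_dvd e l 1" by (rule step_dvd_1[OF assms(1)])
  have s2: "step_dvd e l 2" by (rule step_3_power_part(1)[OF assms(1) s1])
  have s3: "step_dvd e l 3"
    using step_2_power_part(1)[OF assms(1) s1 s2] by (simp add: step_dvd_def)
  have s4: "step_dvd e l 4" by (rule step_dvd_4[OF assms(1) s1 s2 s3])
  have "6 dvd x" if "2 dvd x" "3 dvd x" for x :: nat
    using that by presburger
  from this[OF step_2_power_part(2)[OF assms(1) s1 s2 s3 s4]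
      step_3_power_part(2)[OF assms(1) s1 s2 s3 s4]]
  have s5: "step_dvd e l 5" by (simp add: step_dvd_def)
  have "i \<in> {1, 2, 3, 4, 5}" using assms by auto
  then show ?thesis using s1 s2 s3 s4 s5 by auto
qed

section \<open>Integrality of the terms and the value of \<open>goebel_N\<close>\<close>

lemma goebel_Ints_le_6:
  assumes "k \<ge> 2" "1 \<le> n" "n \<le> 6"
  shows "goebel k l n \<in> \<int>"
  using goebel_eq_goebel_nat[of n k l] step_dvd_le_5[of "k - 1" _ l] assms by simp

lemma goebel_7_Ints_iff:
  assumes "k \<ge> 2"
  shows "goebel k l 7 \<in> \<int> \<longleftrightarrow> \<not> ([k = 2] (mod 6) \<and> [l = 3] (mod 7))"
proof -
  have steps: "step_dvd (k - 1) l i" if "1 \<le> i" "i \<le> 5" for i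
    using step_dvd_le_5[of "k - 1" i l] assms that by simp
  have "goebel k l (Suc 6) \<in> \<int> \<longleftrightarrow> step_dvd (k - 1) l 6"
    using steps by (intro goebel_Suc_Ints_iff) auto
  also have "\<dots> \<longleftrightarrow> \<not> ([k - 1 = 1] (mod 6) \<and> [l = 3] (mod 7))"
    using assms steps by (intro step_dvd_6_iff) auto
  also have "[k - 1 = 1] (mod 6) \<longleftrightarrow> [k = 2] (mod 6)"
    using cong_add_rcancel_nat[of "k - 1" 1 1 6] assms by (simp flip: numeral_2_eq_2)
  finally show ?thesis by simp
qed

lemma goebel_N_ge_7:
  assumes "k \<ge> 2"
  shows "7 \<le> goebel_N k l"
  unfolding goebel_N_def
proof (rule Inf_greatest)
  fix x assume "x \<in> {enat n | n. n > 0 \<and> goebel k l n \<notin> \<int>}"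
  then obtain n where n: "x = enat n" "n > 0" "goebel k l n \<notin> \<int>" by blast
  then have "\<not> n \<le> 6" using goebel_Ints_le_6[of k n l] assms by auto
  then show "7 \<le> x" using n(1) by (simp add: numeral_eq_enat)
qed

lemma goebel_N_eq_7_iff:
  assumes "k \<ge> 2"
  shows "goebel_N k l = 7 \<longleftrightarrow> [k = 2] (mod 6) \<and> [l = 3] (mod 7)"
proof -
  let ?S = "{enat n | n. n > 0 \<and> goebel k l n \<notin> \<int>}"
  have "goebel_N k l = 7 \<longleftrightarrow> goebel k l 7 \<notin> \<int>"
  proof
    assume "goebel k l 7 \<notin> \<int>"
    then have "goebel_N k l \<le> enat 7"
      unfolding goebel_N_def by (intro Inf_lower) auto
    then show "goebel_N k l = 7"
      using goebel_N_ge_7[OF assms, of l] by (simp add: numeral_eq_enat)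
  next
    assume N: "goebel_N k l = 7"
    \<comment> \<open>An empty set would have infimum \<infinity>; a nonempty set in the well-order
      \<open>enat\<close> attains its infimum, so 7 is itself an index of a non-integral
      term.\<close>
    have "?S \<noteq> {}"
    proof
      assume "?S = {}"
      then have "goebel_N k l = \<infinity>"
        unfolding goebel_N_def by (simp only: Inf_enat_def simp_thms if_True)
      then show False using N by simp
    qed
    then have "\<exists>x. x \<in> ?S" by (subst ex_in_conv)
    then have "Inf ?S \<in> ?S" by (rule exE) (rule wellorder_InfI)
    then have "7 \<in> ?S" using N by (simp add: goebel_N_def)
    then show "goebel k l 7 \<notin> \<int>" by (auto simp: numeral_eq_enat)
  qed
  then show ?thesis using goebel_7_Ints_iff[OF assms] by simp
qed

theorem theorem1p2:
  shows "((\<exists>k\<ge>2. \<exists>l\<ge>2. goebel_N k l = 7) \<and> (\<forall>k\<ge>2. \<forall>l\<ge>2. 7 \<le> goebel_N k l)) \<and>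
    (\<forall>k\<ge>2. \<forall>l\<ge>2. \<forall>n\<in>{1..6}. goebel k l n \<in> \<int>) \<and>
    (\<forall>k\<ge>2. \<forall>l\<ge>2. goebel_N k l = 7 \<longleftrightarrow> [k = 2] (mod 6) \<and> [l = 3] (mod 7))"
proof -
  \<comment> \<open>The smallest admissible \<open>k\<close> and \<open>l\<close> in the exceptional
    residue classes witness that the bound is attained.\<close>
  have "goebel_N 2 3 = 7" using goebel_N_eq_7_iff[of 2 3] by simp
  then have "\<exists>k\<ge>2. \<exists>l\<ge>2. goebel_N k l = 7" by (intro exI[of _ "2::nat"] conjI exI[of _ "3::nat"]) auto
  then show ?thesis using goebel_N_ge_7 goebel_N_eq_7_iff goebel_Ints_le_6 by auto
qed

end
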